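(* Let $d\in\{1,3\}$, let $\alpha>0$, let the time step $k>0$ and the mesh size $h=1/N$ ($N$ a positive integer) be arbitrary, and let $\boldsymbol p_h$ and $\hat{\boldsymbol m}_h$ be given $\mathbb{R}^3$-valued grid functions. Then the linear system $$\frac{\frac32\tilde{\boldsymbol m}_h-\boldsymbol p_h}{k}=-\hat{\boldsymbol m}_h\times\Delta_h\tilde{\boldsymbol m}_h-\alpha\,\hat{\boldsymbol m}_h\times\bigl(\hat{\boldsymbol m}_h\times\Delta_h\tilde{\boldsymbol m}_h\bigr),$$ posed at all interior grid points, with $\tilde{\boldsymbol m}_h$ subject to the discrete homogeneous Neumann boundary condition, is uniquely solvable: there is exactly one grid function $\tilde{\boldsymbol m}_h$ satisfying it.
   Context: Domain $\Omega=[0,1]^d$, $d\in\{1,3\}$. Uniform cell-centered grid with $N$ cells in each direction, $h=1/N$; grid points have coordinates $(i-\frac12)h$ in each direction, with interior indices $1\le i\le N$ and ghost indices $0$ and $N+1$. A grid function assigns a vector in $\mathbb{R}^3$ to each interior grid point. The discrete homogeneous Neumann boundary condition defines values at ghost points by $\boldsymbol f_0=\boldsymbol f_1$, $\boldsymbol f_{N+1}=\boldsymbol f_N$ in each coordinate direction (for example $\boldsymbol f_{i,j,0}=\boldsymbol f_{i,j,1}$, $\boldsymbol f_{i,j,N+1}=\boldsymbol f_{i,j,N}$ in the $z$ direction for $d=3$). The discrete Laplacian $\Delta_h$ is the standard second-order centered difference: for $d=1$, $\Delta_h\boldsymbol f_i=(\boldsymbol f_{i+1}-2\boldsymbol f_i+\boldsymbol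 f_{i-1})/h^2$, and for $d=3$ it is the sum of the three analogous one-dimensional second differences in $x,y,z$. The cross product $\times$ of grid functions is the cross product in $\mathbb{R}^3$ taken pointwise. *)

theory Defs
  imports "HOL-Analysis.Analysis"
begin

unbundle cross3_syntax

text \<open>
  The \<open>d\<close> coordinate directions are the elements of a finite index type \<open>'d\<close>, so \<open>d = CARD('d)\<close>.
  The multi-index \<open>i\<close> stands for the cell centre with coordinates \<open>(i $ c - 1/2) / N\<close>.
\<close>

definition interior_indices :: "nat \<Rightarrow> (int ^ 'd) set" where
  "interior_indices N = {i. \<forall>c. 1 \<le> i $ c \<and> i $ c \<le> int N}"

text \<open>
  Extensionality (\<open>undefined\<close> off the interior) makes equality of grid functions the same as
  equality at all interior points, so that uniqueness is meaningful.
\<close>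

definition grid_functions :: "nat \<Rightarrow> (int ^ 'd \<Rightarrow> real ^ 3) set" where
  "grid_functions N = interior_indices N \<rightarrow>\<^sub>E UNIV"

definition neumann_index :: "nat \<Rightarrow> int \<Rightarrow> int" where
  "neumann_index N j = (if j = 0 then 1 else if j = int N + 1 then int N else j)"

text \<open>
  Extension of a grid function to the ghost points by the discrete homogeneous Neumann condition.
  The difference stencil only uses ghost points with a single ghost coordinate; at the remaining
  ones (edges and corners) the value is irrelevant.
\<close>

definition neumann_extension :: "nat \<Rightarrow> (int ^ 'd \<Rightarrow> real ^ 3) \<Rightarrow> (int ^ 'd \<Rightarrow> real ^ 3)" where
  "neumann_extension N f = (\<lambda>i. f (\<chi> c. neumann_index N (i $ c)))"

lemma neumann_extension_interior:
  "i \<in> interior_indices N \<Longrightarrow> neumann_extension N f i = f i"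
proof -
  assume i: "i \<in> interior_indices N"
  have "neumann_index N (i $ c) = i $ c" for c
  proof -
    have "1 \<le> i $ c" "i $ c \<le> int N"
      using i by (auto simp: interior_indices_def)
    then show ?thesis by (auto simp: neumann_index_def)
  qed
  then show ?thesis by (simp add: neumann_extension_def)
qed

lemma neumann_extension_lower:
  assumes "N > 0" "i $ c = 0"
  shows "neumann_extension N f i = neumann_extension N f (i + axis c 1)"
proof -
  have "neumann_index N (i $ c') = neumann_index N ((i + axis c 1) $ c')" for c'
    using assms by (cases "c' = c") (auto simp: neumann_index_def axis_def)
  then show ?thesis by (simp add: neumann_extension_def)
qed

lemma neumann_extension_upper:
  assumes "N > 0" "i $ c = int N + 1"
  shows "neumann_extension N f i = neumann_extension N f (i - axis c 1)"
proof -
  have "neumann_index N (i $ c') = neumann_index N ((i - axis c 1) $ c')" for c'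
    using assms by (cases "c' = c") (auto simp: neumann_index_def axis_def)
  then show ?thesis by (simp add: neumann_extension_def)
qed

definition discrete_laplacian ::
  "real \<Rightarrow> (int ^ 'd::finite \<Rightarrow> real ^ 3) \<Rightarrow> (int ^ 'd \<Rightarrow> real ^ 3)" where
  "discrete_laplacian h f = (\<lambda>i.
     \<Sum>c\<in>UNIV. (f (i + axis c 1) - 2 *\<^sub>R f i + f (i - axis c 1)) /\<^sub>R h\<^sup>2)"

end

(* The grid functions form a finite-dimensional space, so it suffices to prove injectivity.  Write
   w for the discrete Laplacian of m.  If m solves the homogeneous system, the inner product of the
   system with w gives 3/(2k) <m, w> = alpha |mhat x w|^2 pointwise.  The left-hand side sums to a
   nonpositive number by the Neumann condition, so mhat x w vanishes and then so does m. *)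
theory Submission
  imports Defs "HOL-Library.Function_Algebras"
begin

section \<open>Square linear systems on a finite index set\<close>

text \<open>Dimension count: a basis \<open>C\<close> of \<open>span B\<close> is carried to an
  independent set \<open>L\<close> C\<open>of equal size. A vector of\<close>span
  B\<open>outside\<close>span (L \<open>C)\<close> would yield \<open>card C + 1\<close> independent
  vectors inside \<open>span C\<close>.\<close>

lemma (in vector_space) linear_inj_on_span_imp_surj:
  assumes "finite B" and L: "Vector_Spaces.linear scale scale L"
    and into: "L ` span B \<subseteq> span B" and inj: "inj_on L (span B)"
  shows "L ` span B = span B"
proof -
  interpret L: Vector_Spaces.linear scale scale L by (rule L)
  obtain C where C: "C \<subseteq> B" "independent C" "B \<subseteq> span C"
    using maximal_independent_subset[of B] by blast
  have span_C: "span C = span B"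
    by (metis C(1,3) span_eq span_superset subset_trans)
  have fin_C: "finite C"
    using C(1) assms(1) finite_subset by blast
  have indep: "independent (L ` C)"
    using L.independent_inj_on_image C(2) inj span_C by simp
  have card: "card (L ` C) = card C"
    using inj span_C span_superset by (metis card_image inj_on_subset)
  have "x \<in> span (L ` C)" if x: "x \<in> span B" for x
  proof (rule ccontr)
    assume nx: "x \<notin> span (L ` C)"
    then have "independent (insert x (L ` C))"
      using indep by (rule independent_insertI)
    moreover have "insert x (L ` C) \<subseteq> span C"
      using x into span_C span_superset[of C] by blast
    ultimately have "card (insert x (L ` C)) \<le> card C"
      using independent_span_bound[OF fin_C] by blast
    moreover have "x \<notin> L ` C"
      using nx span_base by blast
    ultimately show False
      using card fin_C by simp
  qed
  then show ?thesis
    using into L.span_image span_C by auto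
qed

text \<open>With values off \<open>I\<close> fixed to 0, unknowns and right-hand sides fill the same
  finite-dimensional space, so a trivial kernel forces surjectivity. This reduces existence for the
  scheme to uniqueness of the zero solution.\<close>

lemma square_linear_system_solvable:
  fixes L :: "('a \<Rightarrow> 'b::euclidean_space) \<Rightarrow> 'a \<Rightarrow> 'b"
  assumes fin: "finite I"
    and add: "\<And>f g i. i \<in> I \<Longrightarrow> L (\<lambda>j. f j + g j) i = L f i + L g i"
    and scale: "\<And>r f i. i \<in> I \<Longrightarrow> L (\<lambda>j. r *\<^sub>R f j) i = r *\<^sub>R L f i"
    and inj: "\<And>f i. (\<And>i. i \<in> I \<Longrightarrow> L f i = 0) \<Longrightarrow> i \<in> I \<Longrightarrow> f i = 0"
  shows "\<exists>f. \<forall>i\<in>I. L f i = g i"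
proof -
  \<comment> \<open>Functions become a real vector space under pointwise addition and this explicit
    scaling. \<open>M\<close> truncates \<open>L\<close> to \<open>I\<close> so that it maps
    \<open>V\<close> into itself.\<close>
  define sc :: "real \<Rightarrow> ('a \<Rightarrow> 'b) \<Rightarrow> 'a \<Rightarrow> 'b" where "sc = (\<lambda>r f i. r *\<^sub>R f i)"
  define M where "M = (\<lambda>f i. if i \<in> I then L f i else 0)"
  define V :: "('a \<Rightarrow> 'b) set" where "V = {f. \<forall>i. i \<notin> I \<longrightarrow> f i = 0}"
  \<comment> \<open>\<open>e (j, b)\<close> is the vector \<open>b\<close> concentrated at the point
    \<open>j\<close>. These functions, with \<open>j\<close> in \<open>I\<close> and
    \<open>b\<close> in \<open>Basis\<close>, span \<open>V\<close>.\<close>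
  define e :: "'a \<times> 'b \<Rightarrow> 'a \<Rightarrow> 'b" where "e = (\<lambda>(j, b) i. if i = j then b else 0)"
  define B where "B = e ` (I \<times> Basis)"
  interpret vs: vector_space sc
    by unfold_locales (auto simp: sc_def scaleR_add_left scaleR_add_right fun_eq_iff)
  have sum_apply: "(\<Sum>x\<in>A. F x) i = (\<Sum>x\<in>A. F x i)" for A :: "('a \<times> 'b) set" and F i
    by (induction A rule: infinite_finite_induct) auto
  have "M (f + f') = M f + M f'" for f f'
    using add[of _ f f'] by (auto simp: M_def fun_eq_iff plus_fun_def)
  moreover have "M (sc r f) = sc r (M f)" for r f
    using scale[of _ r f] by (auto simp: M_def fun_eq_iff sc_def)
  ultimately have M: "Vector_Spaces.linear sc sc M"
    by (simp add: Vector_Spaces.linear_iff vs.vector_space_axioms)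
  interpret M: Vector_Spaces.linear sc sc M by (rule M)
  have "vs.span B \<subseteq> V"
  proof (rule vs.span_minimal)
    show "B \<subseteq> V" by (auto simp: B_def V_def e_def)
    show "vs.subspace V" unfolding vs.subspace_def V_def by (auto simp: sc_def)
  qed
  moreover have "f \<in> vs.span B" if "f \<in> V" for f
  proof -
    have expansion: "(\<Sum>x\<in>I \<times> Basis. sc (f (fst x) \<bullet> snd x) (e x) i) = f i" for i
    proof -
      have "(\<Sum>x\<in>I \<times> Basis. sc (f (fst x) \<bullet> snd x) (e x) i)
          = (\<Sum>j\<in>I. \<Sum>b\<in>Basis. (f j \<bullet> b) *\<^sub>R (if i = j then b else 0))"
        by (simp add: sum.cartesian_product sc_def e_def case_prod_unfold)
      also have "\<dots> = (\<Sum>j\<in>I. if i = j then f j else 0)"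
        by (rule sum.cong) (auto simp: euclidean_representation)
      also have "\<dots> = f i"
        using fin that by (auto simp: V_def)
      finally show ?thesis .
    qed
    have "f = (\<Sum>x\<in>I \<times> Basis. sc (f (fst x) \<bullet> snd x) (e x))"
      by (rule ext) (simp only: sum_apply expansion)
    also have "\<dots> \<in> vs.span B"
      by (intro vs.span_sum vs.span_scale vs.span_base) (simp add: B_def)
    finally show ?thesis .
  qed
  ultimately have span_B: "vs.span B = V" by blast
  \<comment> \<open>An element of the kernel vanishes on \<open>I\<close> by \<open>inj\<close> and
    off \<open>I\<close> because it lies in \<open>V\<close>.\<close>
  have "inj_on M (vs.span B)"
  proof (subst M.inj_on_iff_eq_0[OF vs.subspace_span], intro ballI impI)
    fix f assume f: "f \<in> vs.span B" "M f = 0"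
    have "L f i = 0" if "i \<in> I" for i
      using f(2) that by (auto simp: M_def fun_eq_iff split: if_splits)
    then show "f = 0"
      using inj[of f] f(1) span_B by (auto simp: V_def fun_eq_iff)
  qed
  moreover have "M ` vs.span B \<subseteq> vs.span B"
    unfolding span_B by (auto simp: M_def V_def)
  moreover have "finite B"
    using fin by (simp add: B_def)
  ultimately have "M ` V = V"
    using vs.linear_inj_on_span_imp_surj[OF _ M, of B] span_B by simp
  moreover have "(\<lambda>i. if i \<in> I then g i else 0) \<in> V"
    by (simp add: V_def)
  ultimately obtain f where "M f = (\<lambda>i. if i \<in> I then g i else 0)"
    by (metis imageE)
  then have "\<forall>i\<in>I. L f i = g i"
    by (metis M_def)
  then show ?thesis by blast
qed

section \<open>The discrete Neumann Laplacian\<close>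

lemma finite_interior_indices: "finite (interior_indices N :: (int ^ 'd::finite) set)"
proof (rule finite_imageD)
  show "inj_on vec_nth (interior_indices N :: (int ^ 'd) set)"
    by (auto intro: inj_onI simp: vec_nth_inject)
  have "vec_nth ` (interior_indices N :: (int ^ 'd) set) \<subseteq> UNIV \<rightarrow>\<^sub>E {1..int N}"
    by (auto simp: interior_indices_def)
  then show "finite (vec_nth ` (interior_indices N :: (int ^ 'd) set))"
    by (rule finite_subset) (intro finite_PiE; simp)
qed

text \<open>The index map behind the ghost-point extension: with it the extension is a composition,
  and sums over neighbours become reindexed sums over interior cells.\<close>

definition neumann_shift :: "nat \<Rightarrow> int ^ 'd \<Rightarrow> int ^ 'd" where
  "neumann_shift N i = (\<chi> c. neumann_index N (i $ c))"

lemma neumann_extension_shift: "neumann_extension N f i = f (neumann_shift N i)"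
  by (simp add: neumann_extension_def neumann_shift_def)

lemma interior_indicesD:
  assumes "i \<in> interior_indices N"
  shows "1 \<le> i $ c" and "i $ c \<le> int N"
  using assms by (auto simp: interior_indices_def)

lemma neumann_index_interior: "i \<in> interior_indices N \<Longrightarrow> neumann_index N (i $ c) = i $ c"
  using interior_indicesD[of i N c] by (simp add: neumann_index_def)

lemma neumann_shift_interior: "i \<in> interior_indices N \<Longrightarrow> neumann_shift N i = i"
  by (simp add: neumann_shift_def neumann_index_interior vec_eq_iff)

text \<open>Stepping off the upper face gives the coordinate \<open>N + 1\<close>, which reflection
  sends back to \<open>N\<close>, the coordinate of departure.\<close>

lemma neumann_shift_upper:
  assumes "i \<in> interior_indices N" "i $ c = int N"
  shows "neumann_shift N (i + axis c 1) = i"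
proof -
  have "neumann_index N ((i + axis c 1) $ b) = i $ b" for b
    using assms(2) neumann_index_interior[OF assms(1), of b]
    by (cases "b = c") (simp_all add: axis_def neumann_index_def)
  then show ?thesis by (simp add: neumann_shift_def vec_eq_iff)
qed

lemma neumann_shift_lower:
  assumes "i \<in> interior_indices N" "i $ c = 1"
  shows "neumann_shift N (i - axis c 1) = i"
proof -
  have "neumann_index N ((i - axis c 1) $ b) = i $ b" for b
    using assms(2) neumann_index_interior[OF assms(1), of b]
    by (cases "b = c") (simp_all add: axis_def neumann_index_def)
  then show ?thesis by (simp add: neumann_shift_def vec_eq_iff)
qed

lemma interior_indices_add_axis:
  assumes "i \<in> interior_indices N" "i $ c \<noteq> int N"
  shows "i + axis c 1 \<in> interior_indices N"
proof -
  have "1 \<le> (i + axis c 1) $ b \<and> (i + axis c 1) $ b \<le> int N" for b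
    using assms(2) interior_indicesD[OF assms(1), of b]
    by (cases "b = c") (simp_all add: axis_def)
  then show ?thesis by (simp add: interior_indices_def)
qed

lemma interior_indices_diff_axis:
  assumes "i \<in> interior_indices N" "i $ c \<noteq> 1"
  shows "i - axis c 1 \<in> interior_indices N"
proof -
  have "1 \<le> (i - axis c 1) $ b \<and> (i - axis c 1) $ b \<le> int N" for b
    using assms(2) interior_indicesD[OF assms(1), of b]
    by (cases "b = c") (simp_all add: axis_def)
  then show ?thesis by (simp add: interior_indices_def)
qed

lemma neumann_shift_axis_mem:
  assumes "i \<in> interior_indices N"
  shows "neumann_shift N (i + axis c 1) \<in> interior_indices N"
    and "neumann_shift N (i - axis c 1) \<in> interior_indices N"
proof -
  show "neumann_shift N (i + axis c 1) \<in> interior_indices N"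
    using assms neumann_shift_upper[of i N c] interior_indices_add_axis[of i N c]
    by (cases "i $ c = int N") (simp_all add: neumann_shift_interior)
  show "neumann_shift N (i - axis c 1) \<in> interior_indices N"
    using assms neumann_shift_lower[of i N c] interior_indices_diff_axis[of i N c]
    by (cases "i $ c = 1") (simp_all add: neumann_shift_interior)
qed

text \<open>Along each grid line, the two reflected shifts together visit every cell exactly twice.\<close>

lemma sum_neumann_shift:
  fixes g :: "int ^ 'd::finite \<Rightarrow> real"
  shows "(\<Sum>i\<in>interior_indices N. g (neumann_shift N (i + axis c 1)))
       + (\<Sum>i\<in>interior_indices N. g (neumann_shift N (i - axis c 1)))
       = 2 * (\<Sum>i\<in>interior_indices N. g i)"
proof -
  let ?I = "interior_indices N :: (int ^ 'd) set"
  \<comment> \<open>\<open>?U\<close> and \<open>?L\<close> are the upper and lower faces in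
    direction \<open>c\<close>, and the primed sets are their complements. Translation by
    \<open>axis c 1\<close> is a bijection from \<open>?U'\<close> onto \<open>?L'\<close>.\<close>
  let ?U = "{i \<in> ?I. i $ c = int N}" and ?U' = "{i \<in> ?I. i $ c \<noteq> int N}"
  let ?L = "{i \<in> ?I. i $ c = 1}" and ?L' = "{i \<in> ?I. i $ c \<noteq> 1}"
  have split: "(\<Sum>i\<in>?I. F i) = (\<Sum>i\<in>{i \<in> ?I. P i}. F i) + (\<Sum>i\<in>{i \<in> ?I. \<not> P i}. F i)"
    for F :: "int ^ 'd \<Rightarrow> real" and P
    by (subst sum.union_disjoint[symmetric])
      (auto intro: sum.cong finite_subset[OF _ finite_interior_indices])
  have U': "i + axis c 1 \<in> ?L' \<and> neumann_shift N (i + axis c 1) = i + axis c 1" if "i \<in> ?U'" for i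
    using that interior_indices_add_axis[of i N c] interior_indicesD(1)[of i N c]
    by (auto simp: axis_def neumann_shift_interior)
  have L': "i - axis c 1 \<in> ?U' \<and> neumann_shift N (i - axis c 1) = i - axis c 1" if "i \<in> ?L'" for i
    using that interior_indices_diff_axis[of i N c] interior_indicesD(2)[of i N c]
    by (auto simp: axis_def neumann_shift_interior)
  have up: "(\<Sum>i\<in>?U'. g (neumann_shift N (i + axis c 1))) = (\<Sum>i\<in>?L'. g i)"
    by (rule sum.reindex_bij_witness[of _ "\<lambda>i. i - axis c 1" "\<lambda>i. i + axis c 1"])
      (use U' L' in simp_all)
  have down: "(\<Sum>i\<in>?L'. g (neumann_shift N (i - axis c 1))) = (\<Sum>i\<in>?U'. g i)"
    by (rule sum.reindex_bij_witness[of _ "\<lambda>i. i + axis c 1" "\<lambda>i. i - axis c 1"])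
      (use U' L' in simp_all)
  \<comment> \<open>Cells of the face are fixed by the reflected shift and all others are
    translated. The upward shift thus covers \<open>?U\<close> and \<open>?L'\<close>, the downward
    one \<open>?L\<close> and \<open>?U'\<close>; together these are two copies of
    \<open>?I\<close>.\<close>
  have "(\<Sum>i\<in>?I. g (neumann_shift N (i + axis c 1))) = (\<Sum>i\<in>?U. g i) + (\<Sum>i\<in>?L'. g i)"
    by (subst split[where P = "\<lambda>i. i $ c = int N"]) (simp add: up neumann_shift_upper)
  moreover have "(\<Sum>i\<in>?I. g (neumann_shift N (i - axis c 1))) = (\<Sum>i\<in>?L. g i) + (\<Sum>i\<in>?U'. g i)"
    by (subst split[where P = "\<lambda>i. i $ c = 1"]) (simp add: down neumann_shift_lower)
  ultimately show ?thesis
    using split[of g "\<lambda>i. i $ c = int N"] split[of g "\<lambda>i. i $ c = 1"] by simp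
qed

text \<open>In each direction,
  \<open>a \<bullet> b \<le> (a \<bullet> a + b \<bullet> b) / 2\<close> bounds the products of
  \<open>m\<close> with its two neighbours. The resulting bound is half the second difference of
  \<open>m i \<bullet> m i\<close>, which sums to 0 by \<open>sum_neumann_shift\<close>; this
  replaces summation by parts.\<close>

lemma discrete_laplacian_neumann_nonpos:
  fixes m :: "int ^ 'd::finite \<Rightarrow> real ^ 3"
  shows "(\<Sum>i\<in>interior_indices N. m i \<bullet> discrete_laplacian h (neumann_extension N m) i) \<le> 0"
proof -
  let ?I = "interior_indices N :: (int ^ 'd) set"
  let ?p = "\<lambda>c i. neumann_shift N (i + axis c 1)" and ?q = "\<lambda>c i. neumann_shift N (i - axis c 1)"
  let ?D = "\<lambda>c i. m i \<bullet> (m (?p c i) - 2 *\<^sub>R m i + m (?q c i))"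
  have inner_le: "a \<bullet> b \<le> (a \<bullet> a + b \<bullet> b) / 2" for a b :: "real ^ 3"
    using inner_ge_zero[of "a - b"] by (simp add: inner_diff_left inner_diff_right inner_commute)
  have dir: "(\<Sum>i\<in>?I. ?D c i) \<le> 0" for c
  proof -
    let ?g = "\<lambda>i. m i \<bullet> m i"
    have "(\<Sum>i\<in>?I. ?D c i) \<le> (\<Sum>i\<in>?I. (?g (?p c i) + ?g (?q c i) - 2 * ?g i) / 2)"
    proof (rule sum_mono)
      fix i
      show "?D c i \<le> (?g (?p c i) + ?g (?q c i) - 2 * ?g i) / 2"
        using inner_le[of "m i" "m (?p c i)"] inner_le[of "m i" "m (?q c i)"]
        by (simp add: inner_add_right inner_diff_right)
    qed
    also have "\<dots> = 0"
      using sum_neumann_shift[of ?g N c]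
      by (simp add: sum_divide_distrib[symmetric] sum_subtractf sum.distrib sum_distrib_left)
    finally show ?thesis .
  qed
  have "(\<Sum>i\<in>?I. m i \<bullet> discrete_laplacian h (neumann_extension N m) i)
      = (\<Sum>i\<in>?I. \<Sum>c\<in>UNIV. ?D c i / h\<^sup>2)"
    by (rule sum.cong) (auto simp: discrete_laplacian_def neumann_extension_shift
        neumann_shift_interior inner_sum_right divide_inverse mult.commute)
  also have "\<dots> = (\<Sum>c\<in>UNIV. (\<Sum>i\<in>?I. ?D c i) / h\<^sup>2)"
    by (subst sum.swap) (simp add: sum_divide_distrib)
  also have "\<dots> \<le> 0"
    using dir by (intro sum_nonpos) (simp add: divide_nonpos_nonneg)
  finally show ?thesis .
qed

lemma discrete_laplacian_neumann_add:
  "discrete_laplacian h (neumann_extension N (\<lambda>j. f j + g j)) i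
   = discrete_laplacian h (neumann_extension N f) i + discrete_laplacian h (neumann_extension N g) i"
  by (simp add: discrete_laplacian_def neumann_extension_def sum.distrib[symmetric] algebra_simps)

lemma discrete_laplacian_neumann_scaleR:
  "discrete_laplacian h (neumann_extension N (\<lambda>j. r *\<^sub>R f j)) i
   = r *\<^sub>R discrete_laplacian h (neumann_extension N f) i"
  by (simp add: discrete_laplacian_def neumann_extension_def scaleR_sum_right algebra_simps)

text \<open>The reflected neighbours of an interior cell are again interior, so the stencil reads
  interior values only. This permits replacing a solution by its restriction.\<close>

lemma discrete_laplacian_neumann_cong:
  assumes "\<And>j. j \<in> interior_indices N \<Longrightarrow> f j = g j" and "i \<in> interior_indices N"
  shows "discrete_laplacian h (neumann_extension N f) i = discrete_laplacian h (neumann_extension N g) i"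
  using assms
  by (simp add: discrete_laplacian_def neumann_extension_shift neumann_shift_interior
      neumann_shift_axis_mem)

section \<open>The semi-implicit Landau--Lifshitz system\<close>

text \<open>The part of the scheme linear in the unknown, collected on the left; what remains on the
  right is \<open>p i /\<^sub>R k\<close>.\<close>

definition llg_operator ::
  "real \<Rightarrow> real \<Rightarrow> real \<Rightarrow> nat \<Rightarrow> (int ^ 'd::finite \<Rightarrow> real ^ 3) \<Rightarrow>
    (int ^ 'd \<Rightarrow> real ^ 3) \<Rightarrow> int ^ 'd \<Rightarrow> real ^ 3" where
  "llg_operator \<alpha> k h N mhat m i =
     (3/2 / k) *\<^sub>R m i
     + mhat i \<times> discrete_laplacian h (neumann_extension N m) i
     + \<alpha> *\<^sub>R (mhat i \<times> (mhat i \<times> discrete_laplacian h (neumann_extension N m) i))"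

lemma llg_operator_add:
  "llg_operator \<alpha> k h N mhat (\<lambda>j. f j + g j) i
   = llg_operator \<alpha> k h N mhat f i + llg_operator \<alpha> k h N mhat g i"
  by (simp add: llg_operator_def discrete_laplacian_neumann_add cross_add_right algebra_simps)

lemma llg_operator_scaleR:
  "llg_operator \<alpha> k h N mhat (\<lambda>j. r *\<^sub>R f j) i = r *\<^sub>R llg_operator \<alpha> k h N mhat f i"
  by (simp add: llg_operator_def discrete_laplacian_neumann_scaleR cross_mult_right algebra_simps)

lemma llg_operator_cong:
  assumes "\<And>j. j \<in> interior_indices N \<Longrightarrow> f j = g j" and "i \<in> interior_indices N"
  shows "llg_operator \<alpha> k h N mhat f i = llg_operator \<alpha> k h N mhat g i"
  using assms discrete_laplacian_neumann_cong[of N f g i h] by (simp add: llg_operator_def)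

lemma llg_operator_eq_0_imp:
  assumes "\<alpha> > 0" "k > 0"
    and zero: "\<And>i. i \<in> interior_indices N \<Longrightarrow> llg_operator \<alpha> k h N mhat m i = 0"
    and i: "i \<in> interior_indices N"
  shows "m i = 0"
proof -
  let ?I = "interior_indices N"
  let ?w = "discrete_laplacian h (neumann_extension N m)"
  let ?v = "\<lambda>i. mhat i \<times> ?w i"
  have pointwise: "(3/2 / k) * (m j \<bullet> ?w j) = \<alpha> * (?v j \<bullet> ?v j)" if "j \<in> ?I" for j
  proof -
    \<comment> \<open>Cyclic invariance of the triple product turns the damping term into minus a
      square. The precession term is orthogonal to \<open>w\<close> and drops out.\<close>
    have "(a \<times> (a \<times> w)) \<bullet> w = - ((a \<times> w) \<bullet> (a \<times> w))" for a w :: "real ^ 3"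
      by (simp add: cross3_simps)
    then have "llg_operator \<alpha> k h N mhat m j \<bullet> ?w j
        = (3/2 / k) * (m j \<bullet> ?w j) - \<alpha> * (?v j \<bullet> ?v j)"
      by (simp add: llg_operator_def inner_add_left dot_cross_self)
    then show ?thesis using zero[OF that] by simp
  qed
  have "\<alpha> * (\<Sum>j\<in>?I. ?v j \<bullet> ?v j) = (3/2 / k) * (\<Sum>j\<in>?I. m j \<bullet> ?w j)"
    by (simp only: sum_distrib_left pointwise cong: sum.cong)
  also have "\<dots> \<le> 0"
    using discrete_laplacian_neumann_nonpos[where m = m and N = N and h = h] assms(2)
    by (intro mult_nonneg_nonpos) auto
  finally have "(\<Sum>j\<in>?I. ?v j \<bullet> ?v j) \<le> 0"
    using assms(1) by (simp add: mult_le_0_iff)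
  then have "(\<Sum>j\<in>?I. ?v j \<bullet> ?v j) = 0"
    by (meson antisym inner_ge_zero sum_nonneg)
  \<comment> \<open>A vanishing sum of nonnegative terms vanishes termwise. Both cross-product terms
    at \<open>i\<close> contain \<open>?v i\<close>, so only
    \<open>(3/2 / k) *\<^sub>R m i = 0\<close> is left of the equation.\<close>
  then have "?v i = 0"
    using i sum_nonneg_eq_0_iff[OF finite_interior_indices, of N "\<lambda>j. ?v j \<bullet> ?v j"] by simp
  then show ?thesis
    using zero[OF i] assms(2) by (simp add: llg_operator_def)
qed

theorem theorem2p1:
  fixes \<alpha> k h :: real and N :: nat
    and p mhat :: "int ^ 'd::finite \<Rightarrow> real ^ 3"
  assumes "CARD('d) \<in> {1, 3}"
    and "\<alpha> > 0" and "k > 0"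
    and "N > 0" and "h = 1 / real N"
    and "p \<in> grid_functions N" and "mhat \<in> grid_functions N"
  shows "\<exists>!m. m \<in> grid_functions N \<and>
    (\<forall>i\<in>interior_indices N.
       ((3/2) *\<^sub>R m i - p i) /\<^sub>R k =
         - (mhat i \<times> discrete_laplacian h (neumann_extension N m) i)
         - \<alpha> *\<^sub>R (mhat i \<times> (mhat i \<times> discrete_laplacian h (neumann_extension N m) i)))"
proof -
  let ?I = "interior_indices N :: (int ^ 'd) set"
  let ?A = "llg_operator \<alpha> k h N mhat"
  have system_iff: "((3/2) *\<^sub>R m i - p i) /\<^sub>R k =
         - (mhat i \<times> discrete_laplacian h (neumann_extension N m) i)
         - \<alpha> *\<^sub>R (mhat i \<times> (mhat i \<times> discrete_laplacian h (neumann_extension N m) i))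
       \<longleftrightarrow> ?A m i = p i /\<^sub>R k" for m i
  proof -
    have move: "x - q = - b - c \<longleftrightarrow> x + b + c = q" for x q b c :: "real ^ 3"
    proof -
      have "(x - q) - (- b - c) = (x + b + c) - q" by simp
      then show ?thesis by (metis right_minus_eq)
    qed
    have split: "((3/2) *\<^sub>R m i - p i) /\<^sub>R k = (3/2 / k) *\<^sub>R m i - p i /\<^sub>R k"
      by (simp only: scaleR_diff_right scaleR_scaleR divide_inverse mult.commute)
    show ?thesis
      unfolding split llg_operator_def by (rule move)
  qed
  have "\<exists>f. \<forall>i\<in>?I. ?A f i = p i /\<^sub>R k"
  proof (rule square_linear_system_solvable)
    show "finite ?I" by (rule finite_interior_indices)
  \<comment> \<open>The remaining premises are additivity, homogeneity and the trivial kernel of the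
    operator.\<close>
  qed (erule llg_operator_eq_0_imp[OF assms(2,3)] | rule llg_operator_add llg_operator_scaleR | assumption)+
  then obtain f where f: "\<forall>i\<in>?I. ?A f i = p i /\<^sub>R k" ..
  show ?thesis
    unfolding system_iff
  \<comment> \<open>The solution \<open>f\<close> is arbitrary off the interior; restricting it
    gives the value \<open>undefined\<close> there, as \<open>grid_functions\<close> demands, and
    leaves the equations intact by \<open>llg_operator_cong\<close>.\<close>
  proof (rule ex1I[of _ "restrict f ?I"], intro conjI ballI)
    show "restrict f ?I \<in> grid_functions N"
      by (simp add: grid_functions_def)
    show "?A (restrict f ?I) i = p i /\<^sub>R k" if "i \<in> ?I" for i
      using f that llg_operator_cong[of N "restrict f ?I" f i] by simp
  next
    fix m assume m: "m \<in> grid_functions N \<and> (\<forall>i\<in>?I. ?A m i = p i /\<^sub>R k)"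
    \<comment> \<open>The difference of two solutions is written as a sum with a multiple, so that
      \<open>llg_operator_add\<close> and \<open>llg_operator_scaleR\<close> apply directly.\<close>
    have "?A (\<lambda>j. m j + (-1) *\<^sub>R f j) i = 0" if "i \<in> ?I" for i
      using m f that by (simp only: llg_operator_add llg_operator_scaleR) simp
    then have "m i + (-1) *\<^sub>R f i = 0" if "i \<in> ?I" for i
      using llg_operator_eq_0_imp[OF assms(2,3), where m = "\<lambda>j. m j + (-1) *\<^sub>R f j"] that by blast
    then have "m i = f i" if "i \<in> ?I" for i
      using that by fastforce
    then show "m = restrict f ?I"
      using m by (auto simp: grid_functions_def PiE_def extensional_def fun_eq_iff)
  qed
qed

end
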